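(* Let $\xi^*\in\Xi_{\boldsymbol 0}$ be a design for model $\mathcal M$, and let $\boldsymbol c\in\mathbb R^\nu$ be a vector with $\boldsymbol c^{\mathsf T}\boldsymbol f(\boldsymbol x)=1$ for all $\boldsymbol x\in\mathrm{supp}(\xi^* )\setminus\{\boldsymbol 0\}$. Suppose $\widetilde{\mathcal X}\subseteq\mathcal X$ and let the design $\xi^*_{-\boldsymbol 0}$ on $\widetilde{\mathcal X}$ be the conditional measure of $\xi^*$ given $\boldsymbol x\ne\boldsymbol 0$ (so $\mathrm{supp}(\xi^*_{-\boldsymbol 0})=\mathrm{supp}(\xi^* )\setminus\{\boldsymbol 0\}\subseteq\widetilde{\mathcal X}$). Let a parameter point $\boldsymbol\beta=(\beta_0,\tilde{\boldsymbol\beta}^{\mathsf T})^{\mathsf T}$ be given such that $u(\boldsymbol x,\boldsymbol\beta)=\tilde u(\boldsymbol x,\tilde{\boldsymbol\beta})$ for all $\boldsymbol x\in\widetilde{\mathcal X}$ and $u(\boldsymbol 0,\boldsymbol\beta)=\tilde u(\boldsymbol 0,\tilde{\boldsymbol\beta})=:\tilde u_0$, and such that $\boldsymbol f_{\tilde{\boldsymbol\beta}}(\boldsymbol 0)=\boldsymbol 0$. Write $\widetilde{\boldsymbol M}=\widetilde{\boldsymbol M}(\xi^*_{-\boldsymbol 0},\tilde{\boldsymbol\beta})$, assumed nonsingular, and $\tilde\tau=\mathrm{tr}(\widetilde{\boldsymbol M}^{-1})$. Assume that $$\xi^*=\frac{\sqrt{\boldsymbol c^{\mathsf T}\boldsymbol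 c+1}}{\sqrt{\boldsymbol c^{\mathsf T}\boldsymbol c+1}+\sqrt{\tilde u_0\tilde\tau}}\,\xi_{\boldsymbol 0}+\frac{\sqrt{\tilde u_0\tilde\tau}}{\sqrt{\boldsymbol c^{\mathsf T}\boldsymbol c+1}+\sqrt{\tilde u_0\tilde\tau}}\,\xi^*_{-\boldsymbol 0}.$$ For $\boldsymbol x\in\mathcal X$ define $$T_1(\boldsymbol x,\tilde{\boldsymbol\beta})=\frac{\bigl(\sqrt{\boldsymbol c^{\mathsf T}\boldsymbol c+1}+\sqrt{\tilde u_0\tilde\tau}\bigr)^2\bigl(\boldsymbol c^{\mathsf T}\boldsymbol f_{\tilde{\boldsymbol\beta}}(\boldsymbol x)-\tilde u^{1/2}(\boldsymbol x,\tilde{\boldsymbol\beta})\bigr)^2}{\tilde u_0^2}+\frac{2\bigl(\sqrt{\boldsymbol c^{\mathsf T}\boldsymbol c+1}+\sqrt{\tilde u_0\tilde\tau}\bigr)^2}{\tilde u_0\sqrt{\tilde\tau\tilde u_0(\boldsymbol c^{\mathsf T}\boldsymbol c+1)}}\Bigl(\boldsymbol f_{\tilde{\boldsymbol\beta}}^{\mathsf T}(\boldsymbol x)\widetilde{\boldsymbol M}^{-1}\boldsymbol c\,\boldsymbol c^{\mathsf T}\boldsymbol f_{\tilde{\boldsymbol\beta}}(\boldsymbol x)-\boldsymbol c^{\mathsf T}\widetilde{\boldsymbol M}^{-1}\tilde u^{1/2}(\boldsymbol x,\tilde{\boldsymbol\beta})\boldsymbol f_{\tilde{\boldsymbol\beta}}(\boldsymbol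 x)\Bigr),$$ $$T_2(\boldsymbol x,\tilde{\boldsymbol\beta})=2\sqrt{\frac{\tilde\tau}{\tilde u_0(\boldsymbol c^{\mathsf T}\boldsymbol c+1)}}\Bigl(\boldsymbol f_{\tilde{\boldsymbol\beta}}^{\mathsf T}(\boldsymbol x)\widetilde{\boldsymbol M}^{-1}\boldsymbol c\,\boldsymbol c^{\mathsf T}\boldsymbol f_{\tilde{\boldsymbol\beta}}(\boldsymbol x)-\boldsymbol c^{\mathsf T}\widetilde{\boldsymbol M}^{-1}\tilde u^{1/2}(\boldsymbol x,\tilde{\boldsymbol\beta})\boldsymbol f_{\tilde{\boldsymbol\beta}}(\boldsymbol x)\Bigr).$$ Then: (1) If $\xi^*$ is locally A-optimal (at $\boldsymbol\beta$) for model $\mathcal M$ and $T_1(\boldsymbol x,\tilde{\boldsymbol\beta})\ge0$ for all $\boldsymbol x\in\widetilde{\mathcal X}$, then $\xi^*_{-\boldsymbol 0}$ is locally A-optimal (at $\tilde{\boldsymbol\beta}$) for model $\widetilde{\mathcal M}$. (2) Suppose moreover that $u(\boldsymbol x,\boldsymbol\beta)=\tilde u(\boldsymbol x,\tilde{\boldsymbol\beta})$ for all $\boldsymbol x\in\mathcal X$. If $\xi^*_{-\boldsymbol 0}$ is locally A-optimal (at $\tilde{\boldsymbol\beta}$) for model $\widetilde{\mathcal M}$ and $$\boldsymbol f_{\tilde{\boldsymbol\beta}}^{\mathsf T}(\boldsymbol x)\,\widetilde{\boldsymbol M}^{-2}\,\boldsymbol f_{\tilde{\boldsymbol\beta}}(\boldsymbol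 x)\le\tilde\tau\left(1-\frac{\bigl(\boldsymbol c^{\mathsf T}\boldsymbol f_{\tilde{\boldsymbol\beta}}(\boldsymbol x)-\tilde u^{1/2}(\boldsymbol x,\tilde{\boldsymbol\beta})\bigr)^2}{\tilde u_0}\right)-T_2(\boldsymbol x,\tilde{\boldsymbol\beta})\quad\text{for all }\boldsymbol x\in\mathcal X,$$ then $\xi^*$ is locally A-optimal (at $\boldsymbol\beta$) for model $\mathcal M$.
   Context: Let $\nu\ge1$ and let $\mathcal X,\widetilde{\mathcal X}\subseteq\mathbb R^\nu$ be experimental regions. Let $\boldsymbol f=(f_1,\dots,f_\nu)^{\mathsf T}$ be an $\mathbb R^\nu$-valued regression function on $\mathcal X$, none of whose components is the constant $1$. For each model below, the components of its regression function are real-valued, continuous and linearly independent functions on the experimental region of that model. Two generalized linear models are considered. - Model $\widetilde{\mathcal M}$ (without intercept): linear predictor $\tilde\eta=\boldsymbol f^{\mathsf T}(\boldsymbol x)\tilde{\boldsymbol\beta}$, $\boldsymbol x\in\widetilde{\mathcal X}$, $\tilde{\boldsymbol\beta}=(\beta_1,\dots,\beta_\nu)^{\mathsf T}$, regression function $\boldsymbol f$. - Model $\mathcal M$ (with intercept): linear predictor $\eta=\beta_0+\boldsymbol f^{\mathsf T}(\boldsymbol x)\tilde{\boldsymbol\beta}$, $\boldsymbol x\in\mathcal X$, $\boldsymbol\beta=(\beta_0,\tilde{\boldsymbol\beta}^{\mathsf T})^{\mathsf T}$, regression function $(1,\boldsymbol f^{\mathsf T})^{\mathsf T}$. Intensity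 functions: let $U(\eta)=\bigl(a(\phi)V(g^{-1}(\eta))\bigr)^{-1}\bigl(g'(g^{-1}(\eta))\bigr)^{-2}$, where $g$ is the one-to-one differentiable link function, $V$ the mean-variance function and $a(\phi)$ the dispersion factor of the underlying one-parameter exponential family; $U$ is a positive function. Then $\tilde u(\boldsymbol x,\tilde{\boldsymbol\beta})=U(\boldsymbol f^{\mathsf T}(\boldsymbol x)\tilde{\boldsymbol\beta})$ for $\widetilde{\mathcal M}$ and $u(\boldsymbol x,\boldsymbol\beta)=U(\beta_0+\boldsymbol f^{\mathsf T}(\boldsymbol x)\tilde{\boldsymbol\beta})$ for $\mathcal M$. Both formulas, and $\boldsymbol f_{\tilde{\boldsymbol\beta}}(\boldsymbol x)=\tilde u^{1/2}(\boldsymbol x,\tilde{\boldsymbol\beta})\boldsymbol f(\boldsymbol x)$, are used for all $\boldsymbol x\in\mathcal X$. A design $\xi$ on a region is a probability measure with finite support $\mathrm{supp}(\xi)=\{\boldsymbol x_1,\dots,\boldsymbol x_r\}$ in that region and positive weights; $\xi_{\boldsymbol 0}$ is the one-point design at the origin $\boldsymbol 0$. The information matrices are $$\widetilde{\boldsymbol M}(\xi,\tilde{\boldsymbol\beta})=\int_{\widetilde{\mathcal X}}\boldsymbol f_{\tilde{\boldsymbol\beta}}(\boldsymbol x)\boldsymbol f_{\tilde{\boldsymbol\beta}}^{\mathsf T}(\boldsymbol x)\,\xi(\mathrm d\boldsymbol x)$$ for designs on $\widetilde{\mathcal X}$ under $\widetilde{\mathcal M}$, and $$\boldsymbol M(\xi,\boldsymbol\beta)=\int_{\mathcal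 X}u(\boldsymbol x,\boldsymbol\beta)\,(1,\boldsymbol f^{\mathsf T}(\boldsymbol x))^{\mathsf T}(1,\boldsymbol f^{\mathsf T}(\boldsymbol x))\,\xi(\mathrm d\boldsymbol x)$$ for designs on $\mathcal X$ under $\mathcal M$. For a given model and parameter point, a design is locally A-optimal if its information matrix is nonsingular and it minimizes the trace of the inverse information matrix over all designs on the model's experimental region with nonsingular information matrix. $\Xi_{\boldsymbol 0}$ is the set of all designs $\xi$ on $\mathcal X$ such that $\boldsymbol 0\in\mathrm{supp}(\xi)$ and there exists $\boldsymbol c\in\mathbb R^\nu$ with $\boldsymbol c^{\mathsf T}\boldsymbol f(\boldsymbol x)=1$ for all $\boldsymbol x\in\mathrm{supp}(\xi)\setminus\{\boldsymbol 0\}$. *)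

theory Defs
  imports "HOL-Probability.Probability"
begin

text \<open>Intensity function of a generalized linear model with link g on the open set D of
  admissible means, variance function V and dispersion factor a \<phi>; only meaningful for
  \<eta> in the range of g on D.\<close>

definition glm_intensity ::
  "(real \<Rightarrow> real) \<Rightarrow> real \<Rightarrow> (real \<Rightarrow> real) \<Rightarrow> real set \<Rightarrow> (real \<Rightarrow> real) \<Rightarrow> real \<Rightarrow> real"
where
  "glm_intensity a \<phi> V D g \<eta> =
     inverse (a \<phi> * V (the_inv_into D g \<eta>)) * inverse ((deriv g (the_inv_into D g \<eta>))\<^sup>2)"

text \<open>The index None of the type 'n option is the intercept coordinate, so that this is the
  stacked vector of length 1 + CARD('n).\<close>

definition with_intercept :: "real \<Rightarrow> real^'n \<Rightarrow> real^('n::finite option)" where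
  "with_intercept t v = (\<chi> i. case i of None \<Rightarrow> t | Some j \<Rightarrow> v $ j)"

text \<open>Continuity, and linear independence of the family of component functions restricted to S.\<close>

definition regression_function_on :: "(real^'n) set \<Rightarrow> (real^'n \<Rightarrow> real^'k) \<Rightarrow> bool" where
  "regression_function_on S h \<longleftrightarrow>
     (\<forall>i. continuous_on S (\<lambda>x. h x $ i)) \<and>
     (\<forall>b. (\<forall>x\<in>S. (\<Sum>i\<in>UNIV. b $ i * h x $ i) = 0) \<longrightarrow> b = 0)"

definition design_on :: "(real^'n) set \<Rightarrow> (real^'n) pmf \<Rightarrow> bool" where
  "design_on S \<xi> \<longleftrightarrow> finite (set_pmf \<xi>) \<and> set_pmf \<xi> \<subseteq> S"

definition intensity0 :: "(real \<Rightarrow> real) \<Rightarrow> (real^'n \<Rightarrow> real^'n) \<Rightarrow> real^'n \<Rightarrow> real^'n \<Rightarrow> real" where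
  "intensity0 U f b x = U (f x \<bullet> b)"

definition intensity1 ::
  "(real \<Rightarrow> real) \<Rightarrow> (real^'n \<Rightarrow> real^'n) \<Rightarrow> real \<Rightarrow> real^'n \<Rightarrow> real^'n \<Rightarrow> real" where
  "intensity1 U f b0 b x = U (b0 + f x \<bullet> b)"

definition weighted_regression ::
  "(real \<Rightarrow> real) \<Rightarrow> (real^'n \<Rightarrow> real^'n) \<Rightarrow> real^'n \<Rightarrow> real^'n \<Rightarrow> real^'n" where
  "weighted_regression U f b x = sqrt (intensity0 U f b x) *\<^sub>R f x"

definition outer_self :: "real^'k \<Rightarrow> real^'k^'k" where
  "outer_self v = (\<chi> i j. v $ i * v $ j)"

text \<open>Information matrices of the models without (0) and with (1) intercept.\<close>

definition info_matrix0 ::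
  "(real \<Rightarrow> real) \<Rightarrow> (real^'n \<Rightarrow> real^'n) \<Rightarrow> real^'n \<Rightarrow> (real^'n) pmf \<Rightarrow> real^'n^'n" where
  "info_matrix0 U f b \<xi> =
     (LINT x|measure_pmf \<xi>. outer_self (weighted_regression U f b x))"

definition info_matrix1 ::
  "(real \<Rightarrow> real) \<Rightarrow> (real^'n \<Rightarrow> real^'n) \<Rightarrow> real \<Rightarrow> real^'n \<Rightarrow> (real^'n) pmf
     \<Rightarrow> real^('n::finite option)^('n option)" where
  "info_matrix1 U f b0 b \<xi> =
     (LINT x|measure_pmf \<xi>.
        intensity1 U f b0 b x *\<^sub>R outer_self (with_intercept 1 (f x)))"

text \<open>M maps a design to its information matrix at the given parameter point.\<close>

definition locally_A_optimal ::
  "(real^'n) set \<Rightarrow> ((real^'n) pmf \<Rightarrow> real^'k^'k) \<Rightarrow> (real^'n) pmf \<Rightarrow> bool" where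
  "locally_A_optimal S M \<xi> \<longleftrightarrow>
     design_on S \<xi> \<and> invertible (M \<xi>) \<and>
     (\<forall>\<zeta>. design_on S \<zeta> \<and> invertible (M \<zeta>) \<longrightarrow>
          trace (matrix_inv (M \<xi>)) \<le> trace (matrix_inv (M \<zeta>)))"

definition Xi0 :: "(real^'n) set \<Rightarrow> (real^'n \<Rightarrow> real^'n) \<Rightarrow> (real^'n) pmf set" where
  "Xi0 S f = {\<xi>. design_on S \<xi> \<and> 0 \<in> set_pmf \<xi> \<and>
                 (\<exists>c. \<forall>x\<in>set_pmf \<xi> - {0}. c \<bullet> f x = 1)}"

definition T1 ::
  "(real \<Rightarrow> real) \<Rightarrow> (real^'n \<Rightarrow> real^'n) \<Rightarrow> real^'n \<Rightarrow> real^'n^'n \<Rightarrow> real^'n \<Rightarrow> real^'n \<Rightarrow> real"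
where
  "T1 U f b M c x =
    (let u0 = intensity0 U f b 0; \<tau> = trace (matrix_inv M);
         s = sqrt (intensity0 U f b x); fb = weighted_regression U f b x;
         S = sqrt (c \<bullet> c + 1) + sqrt (u0 * \<tau>)
     in S\<^sup>2 * (c \<bullet> fb - s)\<^sup>2 / u0\<^sup>2
        + 2 * S\<^sup>2 / (u0 * sqrt (\<tau> * u0 * (c \<bullet> c + 1)))
          * ((fb \<bullet> (matrix_inv M *v c)) * (c \<bullet> fb) - c \<bullet> (matrix_inv M *v (s *\<^sub>R fb))))"

definition T2 ::
  "(real \<Rightarrow> real) \<Rightarrow> (real^'n \<Rightarrow> real^'n) \<Rightarrow> real^'n \<Rightarrow> real^'n^'n \<Rightarrow> real^'n \<Rightarrow> real^'n \<Rightarrow> real"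
where
  "T2 U f b M c x =
    (let u0 = intensity0 U f b 0; \<tau> = trace (matrix_inv M);
         s = sqrt (intensity0 U f b x); fb = weighted_regression U f b x
     in 2 * sqrt (\<tau> / (u0 * (c \<bullet> c + 1)))
          * ((fb \<bullet> (matrix_inv M *v c)) * (c \<bullet> fb) - c \<bullet> (matrix_inv M *v (s *\<^sub>R fb))))"

end

theory Submission imports Defs begin

text \<open>Local A-optimality of a design with information matrix \<open>M\<close> and weighted regression \<open>h\<close>
  is equivalent to \<open>|M\<^sup>-\<^sup>1 h(x)|\<^sup>2 \<le> tr M\<^sup>-\<^sup>1\<close> on the whole region. Since \<open>c \<bullet> f = 1\<close> off the
  origin, the information matrix with intercept of the mixture \<open>w\<^sub>0 \<xi>\<^sub>0 + w \<xi>\<^sub>m\<close> is a congruence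
  of a block matrix, with inverse
  \<open>(w\<^sub>0 u\<^sub>0)\<^sup>-\<^sup>1 (1, -c)(1, -c)\<^sup>T + w\<^sup>-\<^sup>1 diag(0, Mt\<^sup>-\<^sup>1)\<close>. For the given weights the trace of
  this inverse is a perfect square, and the two optimality inequalities differ, up to a positive
  factor, exactly by \<open>T1\<close>.\<close>

section \<open>Inverses, traces and rank-one matrices\<close>

lemma matrix_inv_inverses:
  fixes A :: "real^'k^'k"
  assumes "invertible A"
  shows "A ** matrix_inv A = mat 1" and "matrix_inv A ** A = mat 1"
  using someI_ex[OF assms[unfolded invertible_def]] by (simp_all add: matrix_inv_def)

lemma matrix_inv_apply:
  fixes A :: "real^'k^'k"
  assumes "invertible A"
  shows "A *v (matrix_inv A *v v) = v" and "matrix_inv A *v (A *v v) = v"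
  using assms by (simp_all add: matrix_vector_mul_assoc matrix_inv_inverses)

text \<open>For square matrices a one-sided inverse is two-sided, so an explicit candidate
  \<open>B\<close> only has to be checked by its action on vectors.\<close>

lemma matrix_inv_eqI:
  fixes A B :: "real^'k^'k"
  assumes "\<And>v. A *v (B *v v) = v"
  shows "invertible A" and "matrix_inv A = B"
proof -
  have AB: "A ** B = mat 1"
    by (rule matrix_eq[THEN iffD2]) (simp add: assms flip: matrix_vector_mul_assoc)
  then have BA: "B ** A = mat 1"
    by (simp add: matrix_left_right_inverse)
  show inv: "invertible A"
    using AB BA by (auto simp: invertible_def)
  have "matrix_inv A ** A = mat 1"
    by (rule matrix_inv_inverses(2)[OF inv])
  then show "matrix_inv A = B"
    by (metis AB matrix_mul_assoc matrix_mul_lid matrix_mul_rid)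
qed

text \<open>Reduces sign and comparison questions about traces to quadratic forms.\<close>

lemma trace_eq_sum_axis:
  fixes A :: "real^'k^'k"
  shows "trace A = (\<Sum>i\<in>UNIV. axis i 1 \<bullet> (A *v axis i 1))"
  by (simp add: trace_def inner_axis' matrix_vector_mul_component inner_axis)

lemma outer_self_mult: "outer_self v *v w = (v \<bullet> w) *\<^sub>R (v :: real^'k)"
  by (simp add: outer_self_def matrix_vector_mult_def vec_eq_iff inner_vec_def sum_distrib_left
      sum_distrib_right mult_ac)

lemma trace_scaleR: "trace (r *\<^sub>R A) = r * trace (A :: real^'k^'k)"
  by (simp add: trace_def sum_distrib_left)

lemma trace_outer_self: "trace (outer_self v) = v \<bullet> (v :: real^'k)"
  by (simp add: trace_def outer_self_def inner_vec_def)

section \<open>Moment matrices of designs\<close>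

text \<open>Common form of both information matrices: the models differ only in the weighted
  regression function \<open>h\<close>, so the optimality criterion is proved once for arbitrary
  \<open>h\<close>.\<close>

definition moment_matrix :: "('a \<Rightarrow> real^'k) \<Rightarrow> 'a pmf \<Rightarrow> real^'k^'k" where
  "moment_matrix h \<xi> = (LINT x|measure_pmf \<xi>. outer_self (h x))"

lemma moment_matrix_mult:
  fixes h :: "'a \<Rightarrow> real^'k"
  assumes "finite (set_pmf \<xi>)"
  shows "moment_matrix h \<xi> *v w = (\<Sum>x\<in>set_pmf \<xi>. (pmf \<xi> x * (h x \<bullet> w)) *\<^sub>R h x)"
proof -
  have "moment_matrix h \<xi> = (\<Sum>x\<in>set_pmf \<xi>. pmf \<xi> x *\<^sub>R outer_self (h x))"
    unfolding moment_matrix_def by (rule integral_measure_pmf) (use assms in auto)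
  moreover have "(\<Sum>x\<in>F. pmf \<xi> x *\<^sub>R outer_self (h x)) *v w
      = (\<Sum>x\<in>F. (pmf \<xi> x * (h x \<bullet> w)) *\<^sub>R h x)" if "finite F" for F
    using that
    by induction (simp_all add: matrix_vector_mult_add_rdistrib outer_self_mult
        flip: scaleR_matrix_vector_assoc)
  ultimately show ?thesis
    using assms by simp
qed

lemma inner_moment_matrix:
  fixes h :: "'a \<Rightarrow> real^'k"
  assumes "finite (set_pmf \<xi>)"
  shows "v \<bullet> (moment_matrix h \<xi> *v w) = (\<Sum>x\<in>set_pmf \<xi>. pmf \<xi> x * (h x \<bullet> v) * (h x \<bullet> w))"
  by (simp add: moment_matrix_mult[OF assms] inner_sum_right inner_commute mult_ac)

lemma moment_matrix_symmetric:
  fixes h :: "'a \<Rightarrow> real^'k"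
  assumes "finite (set_pmf \<xi>)"
  shows "v \<bullet> (moment_matrix h \<xi> *v w) = w \<bullet> (moment_matrix h \<xi> *v v)"
  by (simp add: inner_moment_matrix[OF assms] mult_ac)

text \<open>Writing both arguments as the matrix applied to their preimages transfers its symmetry
  to the inverse.\<close>

lemma inverse_moment_matrix_symmetric:
  fixes h :: "'a \<Rightarrow> real^'k"
  assumes "finite (set_pmf \<xi>)" "invertible (moment_matrix h \<xi>)"
  shows "v \<bullet> (matrix_inv (moment_matrix h \<xi>) *v w) = w \<bullet> (matrix_inv (moment_matrix h \<xi>) *v v)"
  by (metis assms inner_commute matrix_inv_apply(1) moment_matrix_symmetric)

lemma moment_matrix_nonneg:
  fixes h :: "'a \<Rightarrow> real^'k"
  assumes "finite (set_pmf \<xi>)"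
  shows "0 \<le> v \<bullet> (moment_matrix h \<xi> *v v)"
  by (simp add: inner_moment_matrix[OF assms] mult.assoc sum_nonneg)

lemma inverse_moment_matrix_nonneg:
  fixes h :: "'a \<Rightarrow> real^'k"
  assumes "finite (set_pmf \<xi>)" "invertible (moment_matrix h \<xi>)"
  shows "0 \<le> v \<bullet> (matrix_inv (moment_matrix h \<xi>) *v v)"
  by (metis assms inner_commute matrix_inv_apply(1) moment_matrix_nonneg)

lemma moment_matrix_cong:
  assumes "\<And>x. x \<in> set_pmf \<xi> \<Longrightarrow> outer_self (h x) = outer_self (k x)"
  shows "moment_matrix h \<xi> = moment_matrix k \<xi>"
  unfolding moment_matrix_def using assms
  by (intro integral_cong_AE) (auto simp: AE_measure_pmf_iff)

lemma moment_matrix_mixture: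
  fixes h :: "'a \<Rightarrow> real^'k"
  assumes fin: "finite (set_pmf \<xi>)" "finite (set_pmf p)" "finite (set_pmf q)"
    and mix: "\<And>x. pmf \<xi> x = s * pmf p x + t * pmf q x"
  shows "moment_matrix h \<xi> = s *\<^sub>R moment_matrix h p + t *\<^sub>R moment_matrix h q"
proof -
  \<comment> \<open>A design has mass zero off its support, so one finite set can carry all three
    sums.\<close>
  define F where "F = set_pmf \<xi> \<union> set_pmf p \<union> set_pmf q"
  have "moment_matrix h r = (\<Sum>x\<in>F. pmf r x *\<^sub>R outer_self (h x))" if "set_pmf r \<subseteq> F" for r
    unfolding moment_matrix_def
    by (rule integral_measure_pmf) (use that fin in \<open>auto simp: F_def\<close>)
  then show ?thesis
    by (simp add: F_def mix scaleR_add_left sum.distrib scaleR_sum_right subset_iff)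
qed

lemma moment_matrix_return: "moment_matrix h (return_pmf x) = outer_self (h x)"
  unfolding moment_matrix_def
  by (subst integral_measure_pmf[where A = "{x}"]) auto

section \<open>The sensitivity criterion for A-optimality\<close>

text \<open>Sherman-Morrison formula. The factor \<open>s\<close> is included because moving mass to
  one point yields (1 - a) M + a h h^T, which is a multiple of a rank-one update of
  \<open>M\<close>.\<close>

lemma trace_inverse_rank_one_update:
  fixes M :: "real^'k^'k" and h :: "real^'k"
  defines "k \<equiv> matrix_inv M *v h"
  assumes inv: "invertible M" and sym: "\<And>v w. v \<bullet> (matrix_inv M *v w) = w \<bullet> (matrix_inv M *v v)"
    and pos: "0 < s" "1 + t * (h \<bullet> k) \<noteq> 0"
  shows "invertible (s *\<^sub>R (M + t *\<^sub>R outer_self h))"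
    and "trace (matrix_inv (s *\<^sub>R (M + t *\<^sub>R outer_self h)))
       = (trace (matrix_inv M) - t / (1 + t * (h \<bullet> k)) * (k \<bullet> k)) / s"
proof -
  define r where "r = t / (1 + t * (h \<bullet> k))"
  define R where "R = inverse s *\<^sub>R (matrix_inv M - r *\<^sub>R outer_self k)"
  have "(s *\<^sub>R (M + t *\<^sub>R outer_self h)) *v (R *v v) = v" for v
  proof -
    have kv: "k \<bullet> v = h \<bullet> (matrix_inv M *v v)"
      by (metis sym inner_commute k_def)
    have Mk: "M *v k = h"
      by (simp add: k_def matrix_inv_apply inv)
    \<comment> \<open>The equation that determines \<open>r\<close>: it makes the multiple of
      \<open>h\<close> left over in the product vanish.\<close>
    have r: "t - r - t * r * (h \<bullet> k) = 0"
      using pos by (simp add: r_def field_simps)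
    have "(s *\<^sub>R (M + t *\<^sub>R outer_self h)) *v (R *v v)
        = (M + t *\<^sub>R outer_self h) *v ((matrix_inv M - r *\<^sub>R outer_self k) *v v)"
      using pos(1) by (simp add: R_def matrix_vector_mult_scaleR flip: scaleR_matrix_vector_assoc)
    also have "\<dots> = v + ((t - r - t * r * (h \<bullet> k)) * (k \<bullet> v)) *\<^sub>R h"
      by (simp add: outer_self_mult matrix_vector_mult_add_rdistrib
          matrix_vector_mult_diff_rdistrib matrix_vector_mult_diff_distrib
          matrix_vector_mult_scaleR Mk matrix_inv_apply inv algebra_simps inner_diff_right kv
          flip: scaleR_matrix_vector_assoc)
    finally show ?thesis
      by (simp add: r)
  qed
  note R = matrix_inv_eqI[OF this]
  show "invertible (s *\<^sub>R (M + t *\<^sub>R outer_self h))"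
    by (rule R)
  have "trace R = (trace (matrix_inv M) - r * trace (outer_self k)) / s"
    by (simp add: R_def trace_scaleR trace_sub divide_inverse mult.commute)
  then show "trace (matrix_inv (s *\<^sub>R (M + t *\<^sub>R outer_self h)))
       = (trace (matrix_inv M) - t / (1 + t * (h \<bullet> k)) * (k \<bullet> k)) / s"
    by (simp add: R(2) trace_outer_self r_def)
qed

lemma ex_mixture_with_point:
  assumes "design_on S \<xi>" "x \<in> S" "0 < t" "t < 1"
  obtains \<zeta> where "design_on S \<zeta>" "\<And>y. pmf \<zeta> y = (1 - t) * pmf \<xi> y + t * pmf (return_pmf x) y"
proof
  \<comment> \<open>Realises the mixture by a Bernoulli trial that selects \<open>x\<close> with
    probability \<open>t\<close>.\<close>
  define \<zeta> where "\<zeta> = bind_pmf (bernoulli_pmf t) (\<lambda>b. if b then return_pmf x else \<xi>)"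
  show "design_on S \<zeta>"
    using assms by (auto simp: \<zeta>_def design_on_def set_pmf_bernoulli split: if_splits)
  show "pmf \<zeta> y = (1 - t) * pmf \<xi> y + t * pmf (return_pmf x) y" for y
    using assms by (simp add: \<zeta>_def pmf_bind)
qed

text \<open>Moving a small mass to \<open>x\<close> cannot lower the trace at an optimal design. The
  rank-one formula makes the trace an explicit function of that mass, and the claim is the resulting
  one-sided derivative condition at zero.\<close>

lemma A_optimal_imp_sensitivity_le:
  fixes h :: "real^'n \<Rightarrow> real^'k"
  assumes M: "\<And>\<zeta>. design_on S \<zeta> \<Longrightarrow> M \<zeta> = moment_matrix h \<zeta>"
    and opt: "locally_A_optimal S M \<xi>" and x: "x \<in> S"
  shows "(norm (matrix_inv (M \<xi>) *v h x))\<^sup>2 \<le> trace (matrix_inv (M \<xi>))"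
proof -
  define k where "k = matrix_inv (M \<xi>) *v h x"
  define \<tau> where "\<tau> = trace (matrix_inv (M \<xi>))"
  have des: "design_on S \<xi>" and inv: "invertible (M \<xi>)"
    using opt by (auto simp: locally_A_optimal_def)
  then have fin: "finite (set_pmf \<xi>)" and M\<xi>: "M \<xi> = moment_matrix h \<xi>"
    using M by (auto simp: design_on_def)
  have hk: "0 \<le> h x \<bullet> k"
    unfolding k_def M\<xi> using inv M\<xi> fin by (intro inverse_moment_matrix_nonneg) auto
  have ineq: "(1 + t) * (k \<bullet> k) \<le> \<tau> * (1 + t * (h x \<bullet> k))" if t: "0 < t" for t
  proof -
    have den: "0 < 1 + t * (h x \<bullet> k)"
      using hk t by (simp add: add_pos_nonneg)
    \<comment> \<open>The mass t / (1 + t) makes the mixture equal to (1 + t)^-1 (M + t h h^T), the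
      form covered by the rank-one formula.\<close>
    obtain \<zeta> where \<zeta>: "design_on S \<zeta>"
      "\<And>y. pmf \<zeta> y = (1 - t / (1 + t)) * pmf \<xi> y + t / (1 + t) * pmf (return_pmf x) y"
      using t by (rule_tac ex_mixture_with_point[OF des x, of "t / (1 + t)"]) auto
    have "M \<zeta> = (1 - t / (1 + t)) *\<^sub>R M \<xi> + (t / (1 + t)) *\<^sub>R moment_matrix h (return_pmf x)"
      unfolding M[OF \<zeta>(1)] M\<xi> using fin \<zeta> by (intro moment_matrix_mixture) (auto simp: design_on_def)
    also have "\<dots> = inverse (1 + t) *\<^sub>R (M \<xi> + t *\<^sub>R outer_self (h x))"
      using t by (simp add: moment_matrix_return algebra_simps field_simps)
    finally have M\<zeta>: "M \<zeta> = inverse (1 + t) *\<^sub>R (M \<xi> + t *\<^sub>R outer_self (h x))" .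
    have sym: "v \<bullet> (matrix_inv (M \<xi>) *v w) = w \<bullet> (matrix_inv (M \<xi>) *v v)" for v w
      unfolding M\<xi> using inv M\<xi> fin by (intro inverse_moment_matrix_symmetric) auto
    have "invertible (M \<zeta>)"
      and "trace (matrix_inv (M \<zeta>)) = (\<tau> - t / (1 + t * (h x \<bullet> k)) * (k \<bullet> k)) / inverse (1 + t)"
      using trace_inverse_rank_one_update[OF inv sym, of "inverse (1 + t)" t "h x"] t den
      by (simp_all add: M\<zeta> k_def \<tau>_def)
    then have "\<tau> \<le> (\<tau> - t / (1 + t * (h x \<bullet> k)) * (k \<bullet> k)) * (1 + t)"
      using opt \<zeta>(1) unfolding locally_A_optimal_def \<tau>_def by (metis divide_inverse inverse_inverse_eq)
    \<comment> \<open>Clearing the denominator cancels the zeroth-order term and leaves a factor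
      \<open>t\<close> to divide by; what remains is continuous at \<open>t = 0\<close>, where the
      limit below is taken.\<close>
    then have "t * ((1 + t) * (k \<bullet> k)) \<le> t * (\<tau> * (1 + t * (h x \<bullet> k)))"
      using den by (simp add: field_simps)
    then show ?thesis
      using t by simp
  qed
  have "((\<lambda>t. (1 + t) * (k \<bullet> k)) \<longlongrightarrow> (1 + 0) * (k \<bullet> k)) (at_right 0)"
    "((\<lambda>t. \<tau> * (1 + t * (h x \<bullet> k))) \<longlongrightarrow> \<tau> * (1 + 0 * (h x \<bullet> k))) (at_right 0)"
    by (intro tendsto_intros)+
  then have "(1 + 0) * (k \<bullet> k) \<le> \<tau> * (1 + 0 * (h x \<bullet> k))"
    by (intro tendsto_le[OF trivial_limit_at_right_real])
      (auto intro: eventually_mono[OF eventually_at_right_less] ineq)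
  then show ?thesis
    by (simp add: power2_norm_eq_inner k_def \<tau>_def)
qed

text \<open>Convexity of the criterion enters as
  \<open>tr ((N\<^sup>-\<^sup>1 - M\<^sup>-\<^sup>1) N (N\<^sup>-\<^sup>1 - M\<^sup>-\<^sup>1)) \<ge> 0\<close>, which gives
  \<open>tr N\<^sup>-\<^sup>1 \<ge> 2 tr M\<^sup>-\<^sup>1 - tr (M\<^sup>-\<^sup>1 N M\<^sup>-\<^sup>1)\<close>.\<close>

lemma A_optimalI_sensitivity_le:
  fixes h :: "real^'n \<Rightarrow> real^'k"
  assumes M: "\<And>\<zeta>. design_on S \<zeta> \<Longrightarrow> M \<zeta> = moment_matrix h \<zeta>"
    and des: "design_on S \<xi>" and inv: "invertible (M \<xi>)"
    and le: "\<And>x. x \<in> S \<Longrightarrow> (norm (matrix_inv (M \<xi>) *v h x))\<^sup>2 \<le> trace (matrix_inv (M \<xi>))"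
  shows "locally_A_optimal S M \<xi>"
proof -
  define K where "K = matrix_inv (M \<xi>)"
  have fin: "finite (set_pmf \<xi>)" and M\<xi>: "M \<xi> = moment_matrix h \<xi>"
    using des M by (auto simp: design_on_def)
  have symK: "v \<bullet> (K *v w) = w \<bullet> (K *v v)" for v w
    unfolding K_def M\<xi> using inv M\<xi> fin by (intro inverse_moment_matrix_symmetric) auto
  have "trace K \<le> trace (matrix_inv (M \<zeta>))" if \<zeta>: "design_on S \<zeta>" and inv\<zeta>: "invertible (M \<zeta>)" for \<zeta>
  proof -
    define L where "L = matrix_inv (M \<zeta>)"
    have fin\<zeta>: "finite (set_pmf \<zeta>)" "set_pmf \<zeta> \<subseteq> S" and M\<zeta>: "M \<zeta> = moment_matrix h \<zeta>"
      using \<zeta> M by (auto simp: design_on_def)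
    have comp: "h x \<bullet> (K *v axis i 1) = (K *v h x) $ i" for x i
      by (simp add: symK[of "h x"] inner_axis')
    \<comment> \<open>The sum is tr (K N K) with N = \<open>M \<zeta>\<close>. It equals the mean of
      |K h(x)|^2 under \<open>\<zeta>\<close>, so the pointwise bound \<open>le\<close> averages to
      tr K.\<close>
    have "(\<Sum>i\<in>UNIV. (K *v axis i 1) \<bullet> (M \<zeta> *v (K *v axis i 1)))
        = (\<Sum>x\<in>set_pmf \<zeta>. pmf \<zeta> x * (\<Sum>i\<in>UNIV. (h x \<bullet> (K *v axis i 1))\<^sup>2))"
      unfolding M\<zeta> inner_moment_matrix[OF fin\<zeta>(1)] sum_distrib_left
      by (subst sum.swap) (simp only: power2_eq_square mult.assoc)
    also have "\<dots> = (\<Sum>x\<in>set_pmf \<zeta>. pmf \<zeta> x * (norm (K *v h x))\<^sup>2)"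
      unfolding comp power2_norm_eq_inner by (simp add: inner_vec_def power2_eq_square)
    also have "\<dots> \<le> (\<Sum>x\<in>set_pmf \<zeta>. pmf \<zeta> x * trace K)"
      using le fin\<zeta> by (intro sum_mono mult_left_mono) (auto simp: K_def)
    also have "\<dots> = trace K"
      using sum_pmf_eq_1[OF fin\<zeta>(1), of \<zeta>] by (simp flip: sum_distrib_right)
    finally have quad: "(\<Sum>i\<in>UNIV. (K *v axis i 1) \<bullet> (M \<zeta> *v (K *v axis i 1))) \<le> trace K" .
    have "0 \<le> (\<Sum>i\<in>UNIV. (L *v axis i 1 - K *v axis i 1) \<bullet>
        (M \<zeta> *v (L *v axis i 1 - K *v axis i 1)))"
      unfolding M\<zeta> by (intro sum_nonneg moment_matrix_nonneg fin\<zeta>)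
    also have "\<dots> = (\<Sum>i\<in>UNIV. axis i 1 \<bullet> (L *v axis i 1) - 2 * (axis i 1 \<bullet> (K *v axis i 1))
        + (K *v axis i 1) \<bullet> (M \<zeta> *v (K *v axis i 1)))"
    proof (rule sum.cong[OF refl])
      fix i :: 'k
      let ?e = "axis i 1 :: real^'k"
      have L_right: "M \<zeta> *v (L *v ?e) = ?e"
        unfolding L_def by (rule matrix_inv_apply(1)[OF inv\<zeta>])
      \<comment> \<open>Symmetry moves \<open>M \<zeta>\<close> over to \<open>L\<close>, where it
        cancels; the cross terms no longer depend on \<open>\<zeta>\<close>.\<close>
      have LK: "(L *v ?e) \<bullet> (M \<zeta> *v (K *v ?e)) = (K *v ?e) \<bullet> ?e"
        by (metis L_right M\<zeta> fin\<zeta>(1) moment_matrix_symmetric)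
      show "(L *v ?e - K *v ?e) \<bullet> (M \<zeta> *v (L *v ?e - K *v ?e))
        = ?e \<bullet> (L *v ?e) - 2 * (?e \<bullet> (K *v ?e)) + (K *v ?e) \<bullet> (M \<zeta> *v (K *v ?e))"
        using L_right LK
        by (simp add: matrix_vector_mult_diff_distrib inner_diff_left inner_diff_right inner_commute)
    qed
    also have "\<dots> = trace L - 2 * trace K
        + (\<Sum>i\<in>UNIV. (K *v axis i 1) \<bullet> (M \<zeta> *v (K *v axis i 1)))"
      by (simp add: trace_eq_sum_axis sum.distrib sum_subtractf sum_distrib_left)
    finally show ?thesis
      using quad by (simp add: L_def)
  qed
  then show ?thesis
    using des inv by (simp add: locally_A_optimal_def K_def)
qed

section \<open>Vectors and matrices with an intercept coordinate\<close>

lemma sum_option: "(\<Sum>i\<in>UNIV. F i) = F None + (\<Sum>j\<in>UNIV. F (Some j))"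
  for F :: "'n::finite option \<Rightarrow> real"
  by (simp add: UNIV_option_conv sum.reindex)

lemma with_intercept_nth [simp]:
  "with_intercept t v $ None = t" "with_intercept t v $ Some j = v $ j"
  by (simp_all add: with_intercept_def)

lemma inner_with_intercept: "with_intercept s v \<bullet> with_intercept t w = s * t + v \<bullet> w"
  by (simp add: inner_vec_def sum_option)

lemma with_intercept_cases:
  fixes v :: "real^('n::finite option)"
  obtains t w where "v = with_intercept t w"
proof
  show "v = with_intercept (v $ None) (\<chi> j. v $ Some j)"
    by (simp add: vec_eq_iff with_intercept_def split: option.split)
qed

lemma with_intercept_add:
  "with_intercept s v + with_intercept t w = with_intercept (s + t) (v + w)"
  by (simp add: vec_eq_iff with_intercept_def split: option.split)

lemma with_intercept_scaleR: "r *\<^sub>R with_intercept t v = with_intercept (r * t) (r *\<^sub>R v)"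
  by (simp add: vec_eq_iff with_intercept_def split: option.split)

text \<open>The block matrix diag(0, K); it carries the \<open>Mt\<close> part of the inverse
  information matrix.\<close>

definition pad_matrix :: "real^'n^'n \<Rightarrow> real^('n::finite option)^('n option)" where
  "pad_matrix K = (\<chi> i. case i of None \<Rightarrow> 0 | Some j \<Rightarrow> with_intercept 0 (K $ j))"

lemma pad_matrix_mult: "pad_matrix K *v with_intercept t v = with_intercept 0 (K *v v)"
proof -
  have "(pad_matrix K *v with_intercept t v) $ i = with_intercept 0 (K *v v) $ i" for i
    by (cases i) (simp_all add: pad_matrix_def matrix_vector_mul_component inner_with_intercept)
  then show ?thesis
    by (simp add: vec_eq_iff)
qed

lemma trace_pad_matrix: "trace (pad_matrix K) = trace K"
  by (simp add: trace_def sum_option pad_matrix_def)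

text \<open>The action assumed for \<open>M1\<close> is that of the congruence S diag(p, w Mt) S^T
  with S(t, v) = (t + c \<bullet> v, v). Inverting S only changes the sign of \<open>c\<close>,
  which gives the explicit inverse; its trace picks up |(1, -c)|^2 = c \<bullet> c + 1 from the
  intercept.\<close>

lemma intercept_matrix_inverse:
  fixes c :: "real^'n" and M1 :: "real^('n option)^('n option)"
  assumes M1: "\<And>t v. M1 *v with_intercept t v
      = with_intercept (p * t + w * (c \<bullet> (Mt *v (t *\<^sub>R c + v)))) (w *\<^sub>R (Mt *v (t *\<^sub>R c + v)))"
    and pos: "p \<noteq> 0" "w \<noteq> 0" and inv: "invertible Mt"
  shows "invertible M1"
    and "matrix_inv M1 *v with_intercept t v
      = with_intercept ((t - c \<bullet> v) / p) ((1 / w) *\<^sub>R (matrix_inv Mt *v v) - ((t - c \<bullet> v) / p) *\<^sub>R c)"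
    and "trace (matrix_inv M1) = (c \<bullet> c + 1) / p + trace (matrix_inv Mt) / w"
proof -
  define R where "R = (1 / p) *\<^sub>R outer_self (with_intercept 1 (- c)) + (1 / w) *\<^sub>R pad_matrix (matrix_inv Mt)"
  have R: "R *v with_intercept t v
      = with_intercept ((t - c \<bullet> v) / p) ((1 / w) *\<^sub>R (matrix_inv Mt *v v) - ((t - c \<bullet> v) / p) *\<^sub>R c)"
    for t v
    by (simp add: R_def matrix_vector_mult_add_rdistrib outer_self_mult pad_matrix_mult
        inner_with_intercept with_intercept_scaleR with_intercept_add flip: scaleR_matrix_vector_assoc)
  have "M1 *v (R *v v) = v" for v
  proof (cases v rule: with_intercept_cases)
    case (1 t u)
    \<comment> \<open>The two multiples of \<open>c\<close> cancel, so the intercept entry of the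
      product reduces to (t - c \<bullet> u) + c \<bullet> u.\<close>
    have "Mt *v (((t - c \<bullet> u) / p) *\<^sub>R c + ((1 / w) *\<^sub>R (matrix_inv Mt *v u) - ((t - c \<bullet> u) / p) *\<^sub>R c))
        = (1 / w) *\<^sub>R u"
      by (simp add: matrix_vector_mult_scaleR matrix_inv_apply inv)
    then show ?thesis
      using pos by (simp add: 1 R M1)
  qed
  note inverse = matrix_inv_eqI[OF this]
  show "invertible M1"
    by (rule inverse)
  show "matrix_inv M1 *v with_intercept t v
      = with_intercept ((t - c \<bullet> v) / p) ((1 / w) *\<^sub>R (matrix_inv Mt *v v) - ((t - c \<bullet> v) / p) *\<^sub>R c)"
    by (simp add: inverse R)
  have "trace R = trace (outer_self (with_intercept 1 (- c))) / p + trace (pad_matrix (matrix_inv Mt)) / w"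
    by (simp add: R_def trace_scaleR trace_add)
  then show "trace (matrix_inv M1) = (c \<bullet> c + 1) / p + trace (matrix_inv Mt) / w"
    by (simp add: inverse trace_outer_self trace_pad_matrix inner_with_intercept add.commute)
qed

section \<open>Information matrices as moment matrices\<close>

lemma info_matrix0_eq: "info_matrix0 U f b = moment_matrix (weighted_regression U f b)"
  by (simp add: fun_eq_iff info_matrix0_def moment_matrix_def)

lemma outer_self_scaleR: "outer_self (r *\<^sub>R v) = r\<^sup>2 *\<^sub>R outer_self v"
  by (simp add: outer_self_def vec_eq_iff power2_eq_square mult_ac)

text \<open>Squaring \<open>sqrt\<close> returns the intensity only where it is nonnegative, hence
  the restriction to designs on a region with that property.\<close>

lemma info_matrix1_eq:
  assumes "design_on S \<xi>" "\<And>x. x \<in> S \<Longrightarrow> 0 \<le> intensity1 U f b0 b x"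
  shows "info_matrix1 U f b0 b \<xi>
    = moment_matrix (\<lambda>x. sqrt (intensity1 U f b0 b x) *\<^sub>R with_intercept 1 (f x)) \<xi>"
  unfolding info_matrix1_def moment_matrix_def using assms
  by (intro integral_cong_AE) (auto simp: AE_measure_pmf_iff design_on_def outer_self_scaleR)

text \<open>On the support the intercept coordinate is the linear function \<open>c\<close> of
  \<open>h x\<close>, so the stacked vector is L h(x) with L y = (c \<bullet> y, y). The matrix is
  therefore L M L^T, and t c + v is L^T (t, v).\<close>

lemma moment_matrix_with_intercept_mult:
  fixes h :: "'a \<Rightarrow> real^'n" and u :: "'a \<Rightarrow> real"
  assumes fin: "finite (set_pmf \<xi>)"
    and c: "\<And>x. x \<in> set_pmf \<xi> \<Longrightarrow> c \<bullet> h x = u x"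
  shows "moment_matrix (\<lambda>x. with_intercept (u x) (h x)) \<xi> *v with_intercept t v
    = with_intercept (c \<bullet> (moment_matrix h \<xi> *v (t *\<^sub>R c + v))) (moment_matrix h \<xi> *v (t *\<^sub>R c + v))"
proof -
  have "(\<Sum>x\<in>F. with_intercept (p x) (q x)) = with_intercept (\<Sum>x\<in>F. p x) (\<Sum>x\<in>F. q x)"
    for F :: "'a set" and p q
    by (simp add: vec_eq_iff with_intercept_def split: option.split)
  moreover have "u x * t + h x \<bullet> v = h x \<bullet> (t *\<^sub>R c + v)" if "x \<in> set_pmf \<xi>" for x
    using c[OF that] by (simp add: inner_add_right inner_commute mult.commute)
  ultimately show ?thesis
    by (simp add: moment_matrix_mult[OF fin] inner_with_intercept with_intercept_scaleR
        inner_sum_right c)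
qed

section \<open>Transfer of A-optimality between the two models\<close>

theorem theorem3p2:
  fixes X Xt :: "(real^'n) set"
    and f :: "real^'n \<Rightarrow> real^'n"
    and a V g U :: "real \<Rightarrow> real" and \<phi> :: real and D :: "real set"
    and \<beta>0 u0 \<tau> :: real and \<beta>t c :: "real^'n"
    and \<xi> \<xi>m :: "(real^'n) pmf" and Mt :: "real^'n^'n"
  assumes no_const: "\<And>i. \<not> (\<forall>x\<in>X. f x $ i = 1)"
    and reg0: "regression_function_on Xt f"
    and reg1: "regression_function_on X (\<lambda>x. with_intercept 1 (f x))"
    and link: "open D" "inj_on g D" "\<And>\<mu>. \<mu> \<in> D \<Longrightarrow> g differentiable (at \<mu>)"
    and U_def: "U = glm_intensity a \<phi> V D g"
    and U_pos: "\<And>\<eta>. \<eta> \<in> g ` D \<Longrightarrow> 0 < U \<eta>"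
    and predictors: "\<And>x. x \<in> X \<Longrightarrow> f x \<bullet> \<beta>t \<in> g ` D \<and> \<beta>0 + f x \<bullet> \<beta>t \<in> g ` D"
    and xi: "\<xi> \<in> Xi0 X f"
    and c: "\<And>x. x \<in> set_pmf \<xi> - {0} \<Longrightarrow> c \<bullet> f x = 1"
    and sub: "Xt \<subseteq> X"
    and xim: "set_pmf \<xi> - {0} \<noteq> {}" "\<xi>m = cond_pmf \<xi> (- {0})" "design_on Xt \<xi>m"
    and u_eq: "\<And>x. x \<in> Xt \<Longrightarrow> intensity1 U f \<beta>0 \<beta>t x = intensity0 U f \<beta>t x"
    and u0: "intensity1 U f \<beta>0 \<beta>t 0 = intensity0 U f \<beta>t 0" "u0 = intensity0 U f \<beta>t 0"
    and f0: "weighted_regression U f \<beta>t 0 = 0"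
    and Mt: "Mt = info_matrix0 U f \<beta>t \<xi>m" "invertible Mt"
    and tau: "\<tau> = trace (matrix_inv Mt)"
    and mixture: "\<And>x. pmf \<xi> x =
          sqrt (c \<bullet> c + 1) / (sqrt (c \<bullet> c + 1) + sqrt (u0 * \<tau>)) * pmf (return_pmf 0) x
        + sqrt (u0 * \<tau>) / (sqrt (c \<bullet> c + 1) + sqrt (u0 * \<tau>)) * pmf \<xi>m x"
  shows "(locally_A_optimal X (info_matrix1 U f \<beta>0 \<beta>t) \<xi>
           \<and> (\<forall>x\<in>Xt. 0 \<le> T1 U f \<beta>t Mt c x)
         \<longrightarrow> locally_A_optimal Xt (info_matrix0 U f \<beta>t) \<xi>m)
       \<and> ((\<forall>x\<in>X. intensity1 U f \<beta>0 \<beta>t x = intensity0 U f \<beta>t x)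
           \<and> locally_A_optimal Xt (info_matrix0 U f \<beta>t) \<xi>m
           \<and> (\<forall>x\<in>X. weighted_regression U f \<beta>t x \<bullet>
                  ((matrix_inv Mt ** matrix_inv Mt) *v weighted_regression U f \<beta>t x)
                \<le> \<tau> * (1 - (c \<bullet> weighted_regression U f \<beta>t x
                            - sqrt (intensity0 U f \<beta>t x))\<^sup>2 / u0)
                  - T2 U f \<beta>t Mt c x)
         \<longrightarrow> locally_A_optimal X (info_matrix1 U f \<beta>0 \<beta>t) \<xi>)"
proof -
  \<comment> \<open>\<open>A\<close> and \<open>B\<close> are the square roots in the prescribed
    weights. For positive \<open>A\<close> and \<open>B\<close> these weights minimise A^2 / (w0 u0)
    + \<tau> / w subject to w0 + w = 1, with minimum (A + B)^2 / u0.\<close>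
  define A where "A = sqrt (c \<bullet> c + 1)"
  define B where "B = sqrt (u0 * \<tau>)"
  define ut where "ut = intensity0 U f \<beta>t"
  define h where "h = weighted_regression U f \<beta>t"
  define H where "H x = sqrt (intensity1 U f \<beta>0 \<beta>t x) *\<^sub>R with_intercept 1 (f x)" for x
  define M1 where "M1 = info_matrix1 U f \<beta>0 \<beta>t \<xi>"
  define K where "K = matrix_inv Mt"
  define w0 where "w0 = A / (A + B)"
  define w where "w = B / (A + B)"
  have des: "design_on X \<xi>" and zero: "0 \<in> set_pmf \<xi>"
    using xi by (auto simp: Xi0_def)
  then have "0 \<in> X" and fin: "finite (set_pmf \<xi>)"
    by (auto simp: design_on_def)
  have ut_pos: "0 < ut x" and u1_pos: "0 < intensity1 U f \<beta>0 \<beta>t x" if "x \<in> X" for x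
    using U_pos predictors[OF that] by (auto simp: ut_def intensity0_def intensity1_def)
  have u0_pos: "0 < u0"
    using ut_pos[OF \<open>0 \<in> X\<close>] by (simp add: u0(2) ut_def)
  have f_0: "f 0 = 0"
    using f0 u0_pos by (simp add: weighted_regression_def u0(2))
  have info1: "info_matrix1 U f \<beta>0 \<beta>t \<zeta> = moment_matrix H \<zeta>" if "design_on X \<zeta>" for \<zeta>
    unfolding H_def by (rule info_matrix1_eq[OF that]) (simp add: u1_pos less_imp_le)
  have info0: "info_matrix0 U f \<beta>t \<zeta> = moment_matrix h \<zeta>" for \<zeta>
    by (simp add: info_matrix0_eq h_def)
  have Mt_eq: "Mt = moment_matrix h \<xi>m"
    by (simp add: Mt info0)
  have finm: "finite (set_pmf \<xi>m)" and subm: "set_pmf \<xi>m \<subseteq> Xt"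
    using xim(3) by (auto simp: design_on_def)
  have setm: "set_pmf \<xi>m = set_pmf \<xi> - {0}"
    using xim(1) unfolding xim(2) by (subst set_cond_pmf) auto
  have symK: "v \<bullet> (K *v y) = y \<bullet> (K *v v)" for v y
    unfolding K_def Mt_eq using Mt(2) Mt_eq finm by (intro inverse_moment_matrix_symmetric) auto
  have "0 \<le> \<tau>"
    unfolding tau trace_eq_sum_axis using Mt(2) finm unfolding Mt_eq
    by (intro sum_nonneg inverse_moment_matrix_nonneg)
  then have "0 \<le> B"
    using u0_pos by (simp add: B_def)
  \<comment> \<open>With \<open>B = 0\<close> the mixture would put no mass outside the origin,
    contradicting the nonzero support point in \<open>xim\<close>.\<close>
  moreover have "B \<noteq> 0"
  proof
    assume "B = 0"
    obtain x where "x \<in> set_pmf \<xi>" "x \<noteq> 0"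
      using xim(1) by auto
    then show False
      using mixture[of x] \<open>B = 0\<close> by (simp add: B_def[symmetric] set_pmf_iff)
  qed
  ultimately have B: "0 < B"
    by simp
  have A: "0 < A" and A2: "A\<^sup>2 = c \<bullet> c + 1"
    by (simp_all add: A_def add_nonneg_pos)
  have B2: "B\<^sup>2 = u0 * \<tau>"
    using B by (simp add: B_def)
  have \<tau>_pos: "0 < \<tau>"
    using B u0_pos by (simp add: B_def zero_less_mult_iff)
  have w: "0 < w0" "0 < w"
    using A B by (simp_all add: w0_def w_def)

  \<comment> \<open>Splits off the origin, where the stacked regression vector is (1, 0). On the
    support of \<open>\<xi>m\<close> the intensities agree, so the weighted vector there is (sqrt
    (ut x), h x).\<close>
  have "M1 = w0 *\<^sub>R moment_matrix H (return_pmf 0) + w *\<^sub>R moment_matrix H \<xi>m"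
    unfolding M1_def info1[OF des] using mixture fin finm
    by (intro moment_matrix_mixture) (simp_all add: w0_def w_def A_def B_def)
  also have "moment_matrix H (return_pmf 0) = u0 *\<^sub>R outer_self (with_intercept 1 0)"
    using u0_pos u0 by (simp add: moment_matrix_return H_def f_0 outer_self_scaleR)
  also have "moment_matrix H \<xi>m = moment_matrix (\<lambda>x. with_intercept (sqrt (ut x)) (h x)) \<xi>m"
    using subm u_eq
    by (intro moment_matrix_cong)
      (auto simp: H_def h_def ut_def weighted_regression_def with_intercept_scaleR)
  finally have M1_eq: "M1 = w0 *\<^sub>R u0 *\<^sub>R outer_self (with_intercept 1 0)
      + w *\<^sub>R moment_matrix (\<lambda>x. with_intercept (sqrt (ut x)) (h x)) \<xi>m" .
  have "c \<bullet> h x = sqrt (ut x)" if "x \<in> set_pmf \<xi>m" for x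
    using c[of x] that by (simp add: setm h_def weighted_regression_def ut_def)
  note block = moment_matrix_with_intercept_mult[OF finm this]
  have M1: "M1 *v with_intercept t v
      = with_intercept (w0 * u0 * t + w * (c \<bullet> (Mt *v (t *\<^sub>R c + v)))) (w *\<^sub>R (Mt *v (t *\<^sub>R c + v)))" for t v
    by (simp add: M1_eq matrix_vector_mult_add_rdistrib outer_self_mult inner_with_intercept
        Mt_eq block with_intercept_scaleR with_intercept_add flip: scaleR_matrix_vector_assoc)
  have "w0 * u0 \<noteq> 0" "w \<noteq> 0"
    using w u0_pos by simp_all
  note inverse = intercept_matrix_inverse[OF M1 this Mt(2)]
  have trace: "trace (matrix_inv M1) = (A + B)\<^sup>2 / u0"
  proof -
    have "trace (matrix_inv M1) = A\<^sup>2 / (w0 * u0) + \<tau> / w"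
      by (simp add: inverse(3) A2 tau)
    also have "\<dots> = A * (A + B) / u0 + (u0 * \<tau>) / u0 * (A + B) / B"
      using A B u0_pos B2 by (simp add: w0_def w_def power2_eq_square)
    also have "\<dots> = (A + B)\<^sup>2 / u0"
      unfolding B2[symmetric] using A B u0_pos by (simp add: field_simps power2_eq_square)
    finally show ?thesis .
  qed

  \<comment> \<open>\<open>d\<close> is the root intensity times 1 - c \<bullet> f(x), the weighted
    defect of the hyperplane equation; it vanishes on the support of \<open>\<xi>m\<close>.\<close>
  define d where "d x = sqrt (ut x) - c \<bullet> h x" for x
  define G where "G x = c \<bullet> (K *v h x)" for x
  \<comment> \<open>The vector has intercept entry d / (w0 u0) and remaining part K h / w - (d / (w0
    u0)) c. The factor taken out of its squared norm is 1 / w^2, rewritten by B^2 = u0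
    \<tau>.\<close>
  have sens: "(norm (matrix_inv M1 *v H x))\<^sup>2
      = (A + B)\<^sup>2 / (u0 * \<tau>) * ((norm (K *v h x))\<^sup>2 + \<tau> * (d x)\<^sup>2 / u0 - 2 * d x * \<tau> * G x / (A * B))"
    if u: "intensity1 U f \<beta>0 \<beta>t x = intensity0 U f \<beta>t x" for x
  proof -
    define p where "p = w0 * u0"
    have p: "p \<noteq> 0"
      using w u0_pos by (simp add: p_def)
    have "H x = with_intercept (sqrt (ut x)) (h x)"
      by (simp add: H_def h_def u ut_def weighted_regression_def with_intercept_scaleR)
    then have "matrix_inv M1 *v H x
        = with_intercept (d x / p) ((1 / w) *\<^sub>R (K *v h x) - (d x / p) *\<^sub>R c)"
      by (simp add: inverse(2) d_def K_def p_def)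
    then have "(norm (matrix_inv M1 *v H x))\<^sup>2
        = (d x / p)\<^sup>2 * A\<^sup>2 + (norm (K *v h x))\<^sup>2 / w\<^sup>2 - 2 * (d x / p) * G x / w"
      unfolding power2_norm_eq_inner A2 G_def
      by (simp add: inner_with_intercept inner_diff_left inner_diff_right inner_commute
          power2_eq_square algebra_simps add_divide_distrib)
    also have "(d x / p)\<^sup>2 * A\<^sup>2 = (A + B)\<^sup>2 / (u0 * \<tau>) * (\<tau> * (d x)\<^sup>2 / u0)"
      using A B u0_pos \<tau>_pos by (simp add: p_def w0_def field_simps power2_eq_square)
    also have "(norm (K *v h x))\<^sup>2 / w\<^sup>2 = (A + B)\<^sup>2 / (u0 * \<tau>) * (norm (K *v h x))\<^sup>2"
      using A B by (simp add: w_def power_divide flip: B2)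
    also have "2 * (d x / p) * G x / w = (A + B)\<^sup>2 / (u0 * \<tau>) * (2 * d x * \<tau> * G x / (A * B))"
      using A B u0_pos \<tau>_pos by (simp add: p_def w0_def w_def field_simps power2_eq_square)
    finally show ?thesis
      by (simp add: algebra_simps)
  qed
  \<comment> \<open>Divided by the same factor, the trace becomes \<tau>. The criterion with
    intercept is thus the bound |K h|^2 \<le> \<tau> of the model without intercept, with a
    correction in \<open>d\<close> added on the left.\<close>
  have sens_le: "(norm (matrix_inv M1 *v H x))\<^sup>2 \<le> trace (matrix_inv M1)
      \<longleftrightarrow> (norm (K *v h x))\<^sup>2 + \<tau> * (d x)\<^sup>2 / u0 - 2 * d x * \<tau> * G x / (A * B) \<le> \<tau>"
    if "intensity1 U f \<beta>0 \<beta>t x = intensity0 U f \<beta>t x" for x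
  proof -
    have "(A + B)\<^sup>2 / u0 = (A + B)\<^sup>2 / (u0 * \<tau>) * \<tau>" "0 < (A + B)\<^sup>2 / (u0 * \<tau>)"
      using \<tau>_pos u0_pos A B by simp_all
    then show ?thesis
      unfolding trace sens[OF that] by (metis mult_le_cancel_left_pos)
  qed
  \<comment> \<open>Symmetry of \<open>K\<close> collapses the bracket shared by \<open>T1\<close>
    and \<open>T2\<close>.\<close>
  have cross: "(h x \<bullet> (K *v c)) * (c \<bullet> h x) - c \<bullet> (K *v (sqrt (ut x) *\<^sub>R h x)) = - (d x * G x)" for x
    by (simp add: symK[of "h x" c] G_def d_def matrix_vector_mult_scaleR algebra_simps)
  \<comment> \<open>\<open>T1\<close> is the whole correction times the positive common factor, so
    both have the same sign.\<close>
  have T1: "T1 U f \<beta>t Mt c x = (A + B)\<^sup>2 / (u0 * \<tau>) * (\<tau> * (d x)\<^sup>2 / u0 - 2 * d x * \<tau> * G x / (A * B))" for x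
  proof -
    have "sqrt (\<tau> * u0 * (c \<bullet> c + 1)) = A * B"
      by (simp add: A_def B_def real_sqrt_mult mult_ac)
    then have "T1 U f \<beta>t Mt c x = (A + B)\<^sup>2 * (c \<bullet> h x - sqrt (ut x))\<^sup>2 / u0\<^sup>2
        + 2 * (A + B)\<^sup>2 / (u0 * (A * B)) * - (d x * G x)"
      unfolding cross[symmetric]
      by (simp add: T1_def Let_def A_def B_def ut_def h_def K_def u0(2) tau)
    also have "\<dots> = (A + B)\<^sup>2 / (u0 * \<tau>) * (\<tau> * (d x)\<^sup>2 / u0 - 2 * d x * \<tau> * G x / (A * B))"
      unfolding power2_commute[of "c \<bullet> h x"] d_def[symmetric] using A B u0_pos \<tau>_pos
      by (simp add: field_simps power2_eq_square)
    finally show ?thesis .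
  qed
  \<comment> \<open>\<open>T2\<close> is only the mixed part of the correction; the part quadratic
    in \<open>d\<close> stands separately in the bound assumed for the second claim.\<close>
  have T2: "T2 U f \<beta>t Mt c x = - (2 * d x * \<tau> * G x / (A * B))" for x
  proof -
    have "sqrt (\<tau> / (u0 * (c \<bullet> c + 1))) = \<tau> / (A * B)"
    proof -
      have "\<tau> / (A * B) = (\<tau> / sqrt \<tau>) / (sqrt u0 * A)"
        by (simp add: B_def real_sqrt_mult mult_ac)
      also have "\<dots> = sqrt (\<tau> / (u0 * (c \<bullet> c + 1)))"
        unfolding A_def real_div_sqrt[OF \<open>0 \<le> \<tau>\<close>] by (simp only: real_sqrt_mult real_sqrt_divide)
      finally show ?thesis
        by simp
    qed
    then have "T2 U f \<beta>t Mt c x = 2 * (\<tau> / (A * B)) * - (d x * G x)"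
      unfolding cross[symmetric]
      by (simp add: T2_def Let_def ut_def h_def K_def u0(2) tau)
    then show ?thesis
      by simp
  qed

  \<comment> \<open>Nonnegative \<open>T1\<close> means a nonnegative correction, so dropping it
    from the criterion with intercept leaves the criterion without.\<close>
  have one: "locally_A_optimal Xt (info_matrix0 U f \<beta>t) \<xi>m"
    if opt: "locally_A_optimal X (info_matrix1 U f \<beta>0 \<beta>t) \<xi>" and T1_nonneg: "\<forall>x\<in>Xt. 0 \<le> T1 U f \<beta>t Mt c x"
  proof (rule A_optimalI_sensitivity_le[OF info0 xim(3)])
    show "invertible (info_matrix0 U f \<beta>t \<xi>m)"
      using Mt by simp
    fix x assume x: "x \<in> Xt"
    then have "(norm (matrix_inv M1 *v H x))\<^sup>2 \<le> trace (matrix_inv M1)"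
      unfolding M1_def using sub by (intro A_optimal_imp_sensitivity_le[OF info1 opt]) auto
    moreover have "0 \<le> \<tau> * (d x)\<^sup>2 / u0 - 2 * d x * \<tau> * G x / (A * B)"
    proof -
      have "0 < (A + B)\<^sup>2 / (u0 * \<tau>)"
        using \<tau>_pos u0_pos A B by simp
      then show ?thesis
        using T1_nonneg x unfolding T1 by (metis zero_le_mult_iff not_less)
    qed
    ultimately have "(norm (K *v h x))\<^sup>2 \<le> \<tau>"
      using sens_le[OF u_eq[OF x]] by linarith
    then show "(norm (matrix_inv (info_matrix0 U f \<beta>t \<xi>m) *v h x))\<^sup>2
        \<le> trace (matrix_inv (info_matrix0 U f \<beta>t \<xi>m))"
      by (simp add: K_def tau flip: Mt(1))
  qed
  \<comment> \<open>Moving \<open>T2\<close> and the quadratic term to the left turns the assumed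
    bound into the right-hand side of \<open>sens_le\<close>.\<close>
  have two: "locally_A_optimal X (info_matrix1 U f \<beta>0 \<beta>t) \<xi>"
    if u: "\<forall>x\<in>X. intensity1 U f \<beta>0 \<beta>t x = intensity0 U f \<beta>t x"
      and le: "\<forall>x\<in>X. h x \<bullet> ((K ** K) *v h x) \<le> \<tau> * (1 - (c \<bullet> h x - sqrt (ut x))\<^sup>2 / u0) - T2 U f \<beta>t Mt c x"
  proof (rule A_optimalI_sensitivity_le[OF info1 des])
    show "invertible (info_matrix1 U f \<beta>0 \<beta>t \<xi>)"
      using inverse(1) by (simp add: M1_def)
    fix x assume x: "x \<in> X"
    have "h x \<bullet> ((K ** K) *v h x) = (norm (K *v h x))\<^sup>2"
      by (simp add: symK[of "h x"] power2_norm_eq_inner flip: matrix_vector_mul_assoc)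
    moreover have "\<tau> * (1 - (c \<bullet> h x - sqrt (ut x))\<^sup>2 / u0) = \<tau> - \<tau> * (d x)\<^sup>2 / u0"
      by (simp add: d_def power2_commute[of "c \<bullet> h x"] algebra_simps)
    ultimately have "(norm (matrix_inv M1 *v H x))\<^sup>2 \<le> trace (matrix_inv M1)"
      using le x u T2[of x] by (subst sens_le) fastforce+
    then show "(norm (matrix_inv (info_matrix1 U f \<beta>0 \<beta>t \<xi>) *v H x))\<^sup>2
        \<le> trace (matrix_inv (info_matrix1 U f \<beta>0 \<beta>t \<xi>))"
      by (simp add: M1_def)
  qed
  show ?thesis
    using one two unfolding h_def ut_def K_def by blast
qed

end
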